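(* The set of ill-founded trees, viewed as a subset of $2^{\mathbb{N}}$, is not Borel.
   Context: A tree is a prefix-closed subset of $\mathbb{N}^{<\mathbb{N}}$ (the set of finite strings of natural numbers). A tree is ill-founded if it has an infinite branch, i.e. there is $x \in \mathbb{N}^{\mathbb{N}}$ all of whose finite prefixes lie in the tree; otherwise it is well-founded. Trees are identified with elements of the Cantor space $2^{\mathbb{N}}$ by fixing a bijection $\varphi \colon \mathbb{N} \to \mathbb{N}^{<\mathbb{N}}$ and mapping a tree $T$ to the string $x \in 2^{\mathbb{N}}$ with $x_i = 1 \iff \varphi(i) \in T$. *)

theory Defs
  imports "HOL-Analysis.Analysis" "HOL-Library.Sublist"
begin

definition is_tree :: "nat list set \<Rightarrow> bool" where
  "is_tree T \<longleftrightarrow> (\<forall>t\<in>T. \<forall>s. prefix s t \<longrightarrow> s \<in> T)"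

definition infinite_branch :: "nat list set \<Rightarrow> (nat \<Rightarrow> nat) \<Rightarrow> bool" where
  "infinite_branch T x \<longleftrightarrow> (\<forall>n. map x [0..<n] \<in> T)"

definition ill_founded :: "nat list set \<Rightarrow> bool" where
  "ill_founded T \<longleftrightarrow> (\<exists>x. infinite_branch T x)"

text \<open>The Cantor space is the type \<^typ>\<open>nat \<Rightarrow> bool\<close>, whose type class topology is the product of
  the discrete topology on \<^typ>\<open>bool\<close>.\<close>

definition tree_code :: "(nat \<Rightarrow> nat list) \<Rightarrow> nat list set \<Rightarrow> nat \<Rightarrow> bool" where
  "tree_code \<phi> T = (\<lambda>i. \<phi> i \<in> T)"

definition ill_founded_codes :: "(nat \<Rightarrow> nat list) \<Rightarrow> (nat \<Rightarrow> bool) set" where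
  "ill_founded_codes \<phi> = tree_code \<phi> ` {T. is_tree T \<and> ill_founded T}"

end

theory Submission
  imports Defs
begin

text \<open>
  The proof is a diagonal argument against Suslin representations. Call \<open>A\<close> Suslin if membership
  \<open>x \<in> A\<close> means that some \<open>y :: nat \<Rightarrow> nat\<close> has all pairs of prefixes of \<open>x\<close> and \<open>y\<close> in a fixed
  relation \<open>R\<close> between finite strings. Suslin sets are closed under countable unions and
  intersections, so the sets that are Suslin together with their complement form a
  \<open>\<sigma>\<close>-algebra; it contains the sets that depend on one coordinate, and hence every Borel set of
  the Cantor space (\<open>borel_imp_suslin\<close>).

  A relation between finite strings is itself a point of the Cantor space, because there are only
  countably many pairs of strings. So every \<open>x\<close> codes a relation, and that relation together with
  \<open>x\<close> yields a tree \<open>diagonal_tree x\<close> whose branches are the witnesses \<open>y\<close> that put \<open>x\<close> into the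
  Suslin set coded by \<open>x\<close>. The map from \<open>x\<close> to this tree is Borel. If the set of
  ill-founded trees were Borel, the set of all \<open>x\<close> with well-founded \<open>diagonal_tree x\<close> would be
  Borel, hence Suslin, and a code \<open>x\<close> of a relation representing it would belong to it exactly
  if it does not.
\<close>

section \<open>Suslin sets of sequences\<close>

definition suslin :: "(nat \<Rightarrow> 'a) set \<Rightarrow> bool" where
  "suslin A \<longleftrightarrow> (\<exists>R. \<forall>x. x \<in> A \<longleftrightarrow> (\<exists>y :: nat \<Rightarrow> nat. \<forall>n. R (map x [0..<n]) (map y [0..<n])))"

lemma suslin_coordinate: "suslin {x. x i \<in> B}"
proof -
  have "x i \<in> B \<longleftrightarrow> (\<exists>y :: nat \<Rightarrow> nat. \<forall>n. i < length (map x [0..<n]) \<longrightarrow> map x [0..<n] ! i \<in> B)"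
    for x by (auto dest: spec[of _ "Suc i"])
  then show ?thesis
    unfolding suslin_def by (intro exI[of _ "\<lambda>s t. i < length s \<longrightarrow> s ! i \<in> B"]) simp
qed

text \<open>
  A witness for membership in a union is the index \<open>m\<close> of a member followed by a witness for
  that member. The shift by one is why a prefix of length \<open>n + 1\<close> is tested against the relation
  at length \<open>n\<close>.
\<close>

lemma suslin_UN:
  fixes A :: "nat \<Rightarrow> (nat \<Rightarrow> 'a) set"
  assumes "\<And>m. suslin (A m)"
  shows "suslin (\<Union>m. A m)"
proof -
  obtain R where R: "\<And>m x. x \<in> A m \<longleftrightarrow> (\<exists>y :: nat \<Rightarrow> nat. \<forall>n. R m (map x [0..<n]) (map y [0..<n]))"
    using assms unfolding suslin_def by metis
  define R' where "R' s t \<longleftrightarrow> t = [] \<or> R (hd t) (butlast s) (tl t)" for s t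
  have shift: "(\<forall>n. R' (map x [0..<n]) (map y [0..<n])) \<longleftrightarrow>
      (\<forall>n. R (y 0) (map x [0..<n]) (map (\<lambda>k. y (Suc k)) [0..<n]))" for x y
  proof -
    have "R' (map x [0..<Suc n]) (map y [0..<Suc n]) \<longleftrightarrow>
        R (y 0) (map x [0..<n]) (map (\<lambda>k. y (Suc k)) [0..<n])" for n
    proof -
      have "map y [0..<Suc n] = y 0 # map (\<lambda>k. y (Suc k)) [0..<n]"
        by (simp only: map_upt_Suc)
      moreover have "butlast (map x [0..<Suc n]) = map x [0..<n]"
        by simp
      ultimately show ?thesis
        unfolding R'_def by (metis list.distinct(1) list.sel(1,3))
    qed
    moreover have "R' (map x [0..<0]) (map y [0..<0])"
      by (simp add: R'_def)
    ultimately show ?thesis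
      by (metis not0_implies_Suc)
  qed
  have "x \<in> (\<Union>m. A m) \<longleftrightarrow> (\<exists>y :: nat \<Rightarrow> nat. \<forall>n. R' (map x [0..<n]) (map y [0..<n]))" for x
  proof
    assume "x \<in> (\<Union>m. A m)"
    then obtain m y where "\<forall>n. R m (map x [0..<n]) (map y [0..<n])"
      using R by blast
    then have "\<forall>n. R' (map x [0..<n]) (map (case_nat m y) [0..<n])"
      unfolding shift by simp
    then show "\<exists>y :: nat \<Rightarrow> nat. \<forall>n. R' (map x [0..<n]) (map y [0..<n])"
      by (rule exI[of _ "case_nat m y"])
  next
    assume "\<exists>y :: nat \<Rightarrow> nat. \<forall>n. R' (map x [0..<n]) (map y [0..<n])"
    then show "x \<in> (\<Union>m. A m)"
      unfolding shift using R by blast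
  qed
  then show ?thesis
    unfolding suslin_def by blast
qed

text \<open>
  A witness for membership in an intersection interleaves one witness for each member: the
  witness for the \<open>m\<close>-th member sits at the positions \<open>prod_encode (m, k)\<close>. A prefix of the
  interleaved sequence is tested against all those prefixes of the components that it determines.
\<close>

lemma suslin_INT:
  fixes A :: "nat \<Rightarrow> (nat \<Rightarrow> 'a) set"
  assumes "\<And>m. suslin (A m)"
  shows "suslin (\<Inter>m. A m)"
proof -
  obtain R where R: "\<And>m x. x \<in> A m \<longleftrightarrow> (\<exists>y :: nat \<Rightarrow> nat. \<forall>n. R m (map x [0..<n]) (map y [0..<n]))"
    using assms unfolding suslin_def by metis
  define R' where "R' s t \<longleftrightarrow> (\<forall>m n. n \<le> length s \<and> (\<forall>k<n. prod_encode (m, k) < length t) \<longrightarrow>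
      R m (take n s) (map (\<lambda>k. t ! prod_encode (m, k)) [0..<n]))" for s t
  have split: "(\<forall>n. R' (map x [0..<n]) (map y [0..<n])) \<longleftrightarrow>
      (\<forall>m n. R m (map x [0..<n]) (map (\<lambda>k. y (prod_encode (m, k))) [0..<n]))" for x y
  proof -
    have component: "R m (take n (map x [0..<N])) (map (\<lambda>k. map y [0..<N] ! prod_encode (m, k)) [0..<n])
        \<longleftrightarrow> R m (map x [0..<n]) (map (\<lambda>k. y (prod_encode (m, k))) [0..<n])"
      if "n \<le> N" "\<forall>k<n. prod_encode (m, k) < N" for m n N
    proof -
      have "map (\<lambda>k. map y [0..<N] ! prod_encode (m, k)) [0..<n] =
          map (\<lambda>k. y (prod_encode (m, k))) [0..<n]"
        using that by (intro map_cong) auto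
      moreover have "take n (map x [0..<N]) = map x [0..<n]"
        using that by (simp add: take_map)
      ultimately show ?thesis
        by (simp only:)
    qed
    have "\<exists>N\<ge>n. \<forall>k<n. prod_encode (m, k) < N" for m n
    proof -
      have "finite ((\<lambda>k. prod_encode (m, k)) ` {..<n})"
        by simp
      then obtain N where "\<forall>k<n. prod_encode (m, k) < N"
        unfolding finite_nat_set_iff_bounded by auto
      then show ?thesis
        by (intro exI[of _ "max n N"]) auto
    qed
    then show ?thesis
      unfolding R'_def length_map length_upt diff_zero using component by meson
  qed
  have "x \<in> (\<Inter>m. A m) \<longleftrightarrow> (\<exists>y :: nat \<Rightarrow> nat. \<forall>n. R' (map x [0..<n]) (map y [0..<n]))" for x
  proof
    assume "x \<in> (\<Inter>m. A m)"
    then have "\<forall>m. \<exists>y. \<forall>n. R m (map x [0..<n]) (map y [0..<n])"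
      using R by blast
    then obtain y where "\<forall>m n. R m (map x [0..<n]) (map (y m) [0..<n])"
      by metis
    then have "\<forall>n. R' (map x [0..<n]) (map (\<lambda>j. case_prod y (prod_decode j)) [0..<n])"
      unfolding split by simp
    then show "\<exists>y :: nat \<Rightarrow> nat. \<forall>n. R' (map x [0..<n]) (map y [0..<n])"
      by (rule exI[of _ "\<lambda>j. case_prod y (prod_decode j)"])
  next
    assume "\<exists>y :: nat \<Rightarrow> nat. \<forall>n. R' (map x [0..<n]) (map y [0..<n])"
    then show "x \<in> (\<Inter>m. A m)"
      unfolding split using R by blast
  qed
  then show ?thesis
    unfolding suslin_def by blast
qed

text \<open>
  In general Suslin sets are not closed under complement, so the induction over the generation of the Borel
  sets has to carry a representation of the complement along.
\<close>

lemma borel_imp_suslin: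
  fixes A :: "(nat \<Rightarrow> 'a::second_countable_topology) set"
  assumes "A \<in> sets borel"
  shows "suslin A"
proof -
  have "A \<in> sets (PiM UNIV (\<lambda>_ :: nat. borel :: 'a measure))"
    using assms by (simp add: sets_PiM_equal_borel)
  then have "A \<in> sigma_sets UNIV {{x. x i \<in> B} | i B. B \<in> sets (borel :: 'a measure)}"
    by (simp add: sets_PiM_single)
  then have "suslin A \<and> suslin (- A)"
  proof induction
    case (Basic A)
    then obtain i B where "A = {x. x i \<in> B}"
      by blast
    moreover from this have "- A = {x. x i \<in> - B}"
      by auto
    ultimately show ?case
      using suslin_coordinate by metis
  next
    case Empty
    show ?case
      using suslin_coordinate[of undefined "{} :: 'a set"] suslin_coordinate[of undefined "UNIV :: 'a set"]
      by simp
  next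
    case (Compl A)
    then show ?case
      by (simp add: Compl_eq_Diff_UNIV[symmetric])
  next
    case (Union A)
    then show ?case
      by (simp add: suslin_UN suslin_INT)
  qed
  then show ?thesis ..
qed

instance bool :: second_countable_topology
proof
  have "open = generate_topology (UNIV :: bool set set)"
    by (auto simp: fun_eq_iff open_discrete intro: generate_topology.Basis)
  then show "\<exists>B :: bool set set. countable B \<and> open = generate_topology B"
    by (intro exI[of _ UNIV]) (simp add: countable_finite)
qed

section \<open>The diagonal tree of a point\<close>

text \<open>
  Here \<open>x\<close> is used twice: as a point, through its prefixes, and as the code of a relation, which
  holds of \<open>u\<close> and \<open>v\<close> if \<open>x (to_nat (u, v))\<close>. Requiring the relation at all prefixes of \<open>s\<close> makes
  the set prefix-closed without changing its branches.
\<close>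

definition diagonal_tree :: "(nat \<Rightarrow> bool) \<Rightarrow> nat list set" where
  "diagonal_tree x = {s. \<forall>k\<le>length s. x (to_nat (map x [0..<k], take k s))}"

lemma is_tree_diagonal_tree: "is_tree (diagonal_tree x)"
  unfolding is_tree_def diagonal_tree_def
proof safe
  fix t s :: "nat list" and k
  assume t: "\<forall>k\<le>length t. x (to_nat (map x [0..<k], take k t))"
    and "prefix s t" "k \<le> length s"
  then have "take k s = take k t" "k \<le> length t"
    by (auto elim!: prefixE)
  then show "x (to_nat (map x [0..<k], take k s))"
    using t by simp
qed

lemma ill_founded_diagonal_tree_iff:
  "ill_founded (diagonal_tree x) \<longleftrightarrow>
    (\<exists>y :: nat \<Rightarrow> nat. \<forall>n. x (to_nat (map x [0..<n], map y [0..<n])))"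
proof -
  have "map y [0..<n] \<in> diagonal_tree x \<longleftrightarrow>
      (\<forall>k\<le>n. x (to_nat (map x [0..<k], map y [0..<k])))" for y n
    by (auto simp: diagonal_tree_def take_map)
  then show ?thesis
    unfolding ill_founded_def infinite_branch_def by blast
qed

text \<open>
  Membership of a fixed string in \<open>diagonal_tree x\<close> involves a value of \<open>x\<close> at an argument that
  depends on \<open>x\<close>. Quantifying over the countably many values of this argument expresses it by
  countable Boolean operations on conditions about single coordinates.
\<close>

lemma measurable_diagonal_tree_code:
  "(\<lambda>x. tree_code \<phi> (diagonal_tree x)) \<in> borel_measurable borel"
proof -
  have coordinate [measurable]: "Measurable.pred borel (\<lambda>x :: nat \<Rightarrow> bool. x i)" for i
  proof -
    have "(\<lambda>x :: nat \<Rightarrow> bool. x i) \<in> borel_measurable borel"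
      by (rule measurable_product_coordinates)
    then show ?thesis
      by (simp add: measurable_cong_sets[OF refl sets_borel_eq_count_space])
  qed
  have "tree_code \<phi> (diagonal_tree x) i \<longleftrightarrow>
      (\<forall>k\<le>length (\<phi> i). \<forall>u. length u = k \<and> (\<forall>j<k. u ! j \<longleftrightarrow> x j) \<longrightarrow>
        x (to_nat (u, take k (\<phi> i))))" for x i
  proof -
    have "length u = k \<and> (\<forall>j<k. u ! j \<longleftrightarrow> x j) \<longleftrightarrow> u = map x [0..<k]" for u k
      by (simp add: list_eq_iff_nth_eq cong: conj_cong)
    then show ?thesis
      by (simp only: tree_code_def diagonal_tree_def mem_Collect_eq simp_thms)
  qed
  moreover have "Measurable.pred borel (\<lambda>x. \<forall>k\<le>length (\<phi> i). \<forall>u.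
      length u = k \<and> (\<forall>j<k. u ! j \<longleftrightarrow> x j) \<longrightarrow> x (to_nat (u, take k (\<phi> i))))" for i
    by measurable
  ultimately have "Measurable.pred borel (\<lambda>x. tree_code \<phi> (diagonal_tree x) i)" for i
    by (simp only:)
  then have "(\<lambda>x. tree_code \<phi> (diagonal_tree x) i) \<in> borel_measurable borel" for i
    by (simp add: measurable_cong_sets[OF refl sets_borel_eq_count_space])
  then show ?thesis
    by (rule measurable_coordinatewise_then_product)
qed

section \<open>The ill-founded trees\<close>

lemma tree_code_in_ill_founded_codes_iff:
  assumes "surj \<phi>" and "is_tree T"
  shows "tree_code \<phi> T \<in> ill_founded_codes \<phi> \<longleftrightarrow> ill_founded T"
proof -
  have "T' = T" if "tree_code \<phi> T = tree_code \<phi> T'" for T'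
  proof (rule set_eqI)
    fix s
    obtain i where "s = \<phi> i"
      using assms(1) by (metis surjD)
    then show "s \<in> T' \<longleftrightarrow> s \<in> T"
      using that by (auto simp: tree_code_def dest: fun_cong[of _ _ i])
  qed
  then show ?thesis
    using assms(2) by (auto simp: ill_founded_codes_def)
qed

theorem theorem7p16:
  fixes \<phi> :: "nat \<Rightarrow> nat list"
  assumes "bij \<phi>"
  shows "ill_founded_codes \<phi> \<notin> sets (borel :: (nat \<Rightarrow> bool) measure)"
proof
  assume borel: "ill_founded_codes \<phi> \<in> sets (borel :: (nat \<Rightarrow> bool) measure)"
  define D where "D = {x. \<not> ill_founded (diagonal_tree x)}"
  have "D = (\<lambda>x. tree_code \<phi> (diagonal_tree x)) -` (- ill_founded_codes \<phi>) \<inter> space borel"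
    using tree_code_in_ill_founded_codes_iff[OF bij_is_surj[OF assms] is_tree_diagonal_tree]
    by (auto simp: D_def)
  also have "\<dots> \<in> sets borel"
    using borel by (intro measurable_sets[OF measurable_diagonal_tree_code]) (rule borel_comp)
  finally obtain R where R: "\<And>x. x \<in> D \<longleftrightarrow> (\<exists>y :: nat \<Rightarrow> nat. \<forall>n. R (map x [0..<n]) (map y [0..<n]))"
    using borel_imp_suslin[of D] unfolding suslin_def by metis
  define x where "x i = case_prod R (from_nat i)" for i
  have "x \<in> D \<longleftrightarrow> ill_founded (diagonal_tree x)"
  proof -
    have "x (to_nat (u, v)) = R u v" for u v
      by (simp add: x_def)
    then show ?thesis
      by (simp only: R ill_founded_diagonal_tree_iff)
  qed
  then show False
    by (simp add: D_def)
qed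

end
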